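(* Let $X$ be a Banach sequence space over $\mathbb{K}$. The following statements are equivalent. (1) $X$ is symmetric. (2) For every bounded sequence $x\in\mathbb{K}^{\mathbb{N}}$, one has $x\in X$ if and only if $x^{*}\in X$ and, in this case, $\|x\|=\|x^{*}\|$.
   Context: $\mathbb{K}=\mathbb{R}$ or $\mathbb{C}$, and $\mathbb{N}=\{1,2,3,\dots\}$. A Banach sequence space is a linear subspace $X$ of $\mathbb{K}^{\mathbb{N}}$ endowed with a complete norm $\|\cdot\|$ such that, if $x=(x_n)_n\in\mathbb{K}^{\mathbb{N}}$ and $y=(y_n)_n\in X$ satisfy $|x_n|\le|y_n|$ for every $n$, then $x\in X$ and $\|x\|\le\|y\|$. Standing assumption: every Banach sequence space (symmetric or not) contains all canonical unit vectors $e_k$ ($1$ in position $k$, $0$ elsewhere) and $\|e_k\|=1$ for all $k\in\mathbb{N}$; consequently $\ell_1\hookrightarrow X\hookrightarrow\ell_\infty$ with inclusions of norm one, so all elements of $X$ are bounded sequences. A Banach sequence space $X$ is symmetric if $x_\sigma=(x_{\sigma(n)})_n\in X$ and $\|x_\sigma\|=\|x\|$ for every $x\in X$ and every permutation (bijection) $\sigma$ of $\mathbb{N}$. The decreasing rearrangement $x^{*}=(x_n^{*})_n$ of a bounded sequence $x=(x_n)_n$ is $x_n^{*}=\inf\{\sup_{k\in\mathbb{N}\setminus J}|x_k| : J\subset\mathbb{N},\ \operatorname{card}J<n\}$. *)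

theory Defs
  imports "HOL-Analysis.Analysis"
begin

text \<open>
  Sequences indexed by the positive integers are rendered as functions on \<^typ>\<open>nat\<close>: the
  \<open>n\<close>-th term of a sequence is its value at \<open>n - 1\<close>. The scalar field is the type
  \<^typ>\<open>'a\<close>, to be instantiated with \<^typ>\<open>real\<close> or \<^typ>\<open>complex\<close>.
  A sequence space is a pair of its carrier \<open>X\<close> and its norm \<open>N\<close>; the values of
  \<open>N\<close> outside \<open>X\<close> are irrelevant.
\<close>

definition unit_seq :: "nat \<Rightarrow> nat \<Rightarrow> 'a::real_normed_field" where
  "unit_seq k = (\<lambda>n. if n = k then 1 else 0)"

locale banach_sequence_space =
  fixes X :: "(nat \<Rightarrow> 'a::real_normed_field) set"
    and N :: "(nat \<Rightarrow> 'a) \<Rightarrow> real"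
  assumes zero_mem: "(\<lambda>n. 0) \<in> X"
    and add_mem: "x \<in> X \<Longrightarrow> y \<in> X \<Longrightarrow> (\<lambda>n. x n + y n) \<in> X"
    and scale_mem: "x \<in> X \<Longrightarrow> (\<lambda>n. c * x n) \<in> X"
    and norm_nonneg: "x \<in> X \<Longrightarrow> 0 \<le> N x"
    and norm_eq_zero: "x \<in> X \<Longrightarrow> N x = 0 \<longleftrightarrow> x = (\<lambda>n. 0)"
    and norm_triangle: "x \<in> X \<Longrightarrow> y \<in> X \<Longrightarrow> N (\<lambda>n. x n + y n) \<le> N x + N y"
    and norm_scale: "x \<in> X \<Longrightarrow> N (\<lambda>n. c * x n) = norm c * N x"
    and complete: "(\<And>i. s i \<in> X) \<Longrightarrow>
        (\<And>e. e > 0 \<Longrightarrow> \<exists>M. \<forall>i\<ge>M. \<forall>j\<ge>M. N (\<lambda>n. s i n - s j n) < e) \<Longrightarrow>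
        \<exists>x\<in>X. (\<lambda>i. N (\<lambda>n. s i n - x n)) \<longlonglongrightarrow> 0"
    and solid_mem: "y \<in> X \<Longrightarrow> (\<And>n. norm (x n) \<le> norm (y n)) \<Longrightarrow> x \<in> X"
    and solid_norm: "y \<in> X \<Longrightarrow> (\<And>n. norm (x n) \<le> norm (y n)) \<Longrightarrow> N x \<le> N y"
    and unit_mem: "unit_seq k \<in> X"
    and norm_unit: "N (unit_seq k) = 1"

definition symmetric_space ::
    "(nat \<Rightarrow> 'a::real_normed_field) set \<Rightarrow> ((nat \<Rightarrow> 'a) \<Rightarrow> real) \<Rightarrow> bool" where
  "symmetric_space X N \<longleftrightarrow>
     (\<forall>x\<in>X. \<forall>\<sigma>. bij \<sigma> \<longrightarrow> (\<lambda>n. x (\<sigma> n)) \<in> X \<and> N (\<lambda>n. x (\<sigma> n)) = N x)"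

text \<open>
  Because of the index shift, the condition \<open>card J < n\<close> for the \<open>n\<close>-th term becomes
  \<open>card J \<le> n\<close>. Finiteness of \<open>J\<close> is explicit since \<^const>\<open>card\<close> is
  \<open>0\<close> on infinite sets. The real infima are embedded into the scalar field. The suprema
  and infima are the mathematical ones only for bounded \<open>x\<close>.
\<close>

definition decreasing_rearrangement ::
    "(nat \<Rightarrow> 'a::real_normed_field) \<Rightarrow> nat \<Rightarrow> 'a" where
  "decreasing_rearrangement x =
     (\<lambda>n. of_real (INF J\<in>{J. finite J \<and> card J \<le> n}. SUP k\<in>UNIV - J. norm (x k)))"

end

theory Submission
  imports Defs
begin

text \<open>
  Rearrangement invariance implies symmetry because the decreasing rearrangement depends only on
  the cardinalities of the superlevel sets of \<open>|x|\<close> (lemma \<open>rearr_le_iff\<close>), and these are invariant under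
  permutations.

  For the converse the difficulty is that \<open>x\<^sup>*\<close> need not be a permutation of \<open>|x|\<close>. If \<open>x\<close>
  is a null sequence with infinite support and at least one zero, then \<open>x\<^sup>*\<close> has lost the zeros;
  if \<open>x\<close> is not null, all terms below the limit of \<open>x\<^sup>*\<close> disappear. Both effects are covered
  by one principle (lemma \<open>injective_domination\<close>): in a symmetric space, if \<open>|v n| \<le> |u (g n)|\<close> on
  the support of \<open>v\<close> for an \<^emph>\<open>injective\<close> \<open>g\<close>, and \<open>u \<in> X\<close>, then \<open>v \<in> X\<close> and
  \<open>\<parallel>v\<parallel> \<le> \<parallel>u\<parallel>\<close>. An injection extends to a permutation as soon as its domain and its range
  both have infinite complement. To enforce this, the support of \<open>v\<close> is divided into
  \<open>m + 1\<close> infinite pieces. Leaving out one piece creates the room required, and \<open>v\<close> is \<open>1 / m\<close>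
  times the sum of the \<open>m + 1\<close> truncations so obtained. Hence \<open>\<parallel>v\<parallel> \<le> ((m + 1) / m) \<parallel>u\<parallel>\<close>,
  and \<open>m\<close> is arbitrary.

  It remains to compare \<open>x\<close> and \<open>x\<^sup>*\<close> injectively in both directions, which is possible up to a
  factor \<open>q > 1\<close>: a greedy choice places \<open>x\<^sup>*\<close> below \<open>q |x|\<close>
  (lemma \<open>rearr_below_sequence\<close>), and ranking the large terms of \<open>x\<close> by size places \<open>|x|\<close>
  below \<open>q x\<^sup>*\<close> (lemma \<open>sequence_below_rearr\<close>). Letting \<open>q\<close> tend to \<open>1\<close>
  gives \<open>\<parallel>x\<parallel> = \<parallel>x\<^sup>*\<parallel>\<close>.
\<close>

section \<open>Injections of the natural numbers\<close>

lemma injection_extends_to_bijection: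
  fixes g :: "nat \<Rightarrow> nat"
  assumes "inj_on g S" "infinite (- S)" "infinite (- g ` S)"
  obtains \<sigma> where "bij \<sigma>" "\<And>n. n \<in> S \<Longrightarrow> \<sigma> n = g n"
proof -
  have "bij_betw (enumerate (- g ` S) \<circ> inv_into UNIV (enumerate (- S))) (- S) (- g ` S)"
    using bij_betw_trans[OF bij_betw_inv_into[OF bij_enumerate[OF assms(2)]]
        bij_enumerate[OF assms(3)]] .
  then obtain k where k: "bij_betw k (- S) (- g ` S)" by blast
  define \<sigma> where "\<sigma> n = (if n \<in> S then g n else k n)" for n
  have 1: "bij_betw \<sigma> S (g ` S)"
    using assms(1) unfolding \<sigma>_def by (auto simp: bij_betw_def inj_on_def)
  have 2: "bij_betw \<sigma> (- S) (- g ` S)"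
    using k by (subst bij_betw_cong[of _ _ k]) (auto simp: \<sigma>_def)
  have "bij_betw \<sigma> (S \<union> - S) (g ` S \<union> - g ` S)"
    by (rule bij_betw_combine[OF 1 2]) auto
  then have "bij \<sigma>" by (simp add: Compl_partition)
  then show thesis by (rule that) (simp add: \<sigma>_def)
qed

lemma infinite_set_colouring:
  fixes S :: "nat set"
  assumes "infinite S" "0 < k"
  obtains c :: "nat \<Rightarrow> nat"
  where "\<And>n. c n < k" "\<And>i. i < k \<Longrightarrow> infinite {n \<in> S. c n = i}"
proof -
  define e where "e = enumerate S"
  have e: "bij_betw e UNIV S" unfolding e_def by (rule bij_enumerate[OF assms(1)])
  define c where "c n = inv_into UNIV e n mod k" for n
  have "infinite {n \<in> S. c n = i}" if "i < k" for i
  proof -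
    have inj: "inj e" using e by (simp add: bij_betw_def)
    have "inj (\<lambda>m. e (i + k * m))"
      using assms(2) by (auto intro!: injI dest!: injD[OF inj])
    moreover have "range (\<lambda>m. e (i + k * m)) \<subseteq> {n \<in> S. c n = i}"
      using e inj that by (auto simp: c_def bij_betw_def)
    ultimately show ?thesis
      using finite_subset range_inj_infinite by blast
  qed
  moreover have "c n < k" for n using assms(2) by (simp add: c_def)
  ultimately show thesis by (rule that[rotated])
qed

lemma greedy_injective_choice:
  fixes A :: "nat \<Rightarrow> 'b set"
  assumes "\<And>n. infinite (A n) \<or> n < card (A n)"
  obtains h where "inj h" "\<And>n. h n \<in> A n"
proof -
  have "\<exists>h. \<forall>n. h n \<in> A n \<and> h n \<notin> h ` {..<n}"
  proof (rule dependent_wellorder_choice[where P = "\<lambda>f n r. r \<in> A n \<and> r \<notin> f ` {..<n}"])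
    fix r :: 'b and f g :: "nat \<Rightarrow> 'b" and n :: nat
    assume "\<And>m. m < n \<Longrightarrow> f m = g m"
    then have "f ` {..<n} = g ` {..<n}" by (auto intro!: image_cong)
    then show "(r \<in> A n \<and> r \<notin> f ` {..<n}) = (r \<in> A n \<and> r \<notin> g ` {..<n})" by simp
  next
    fix n :: nat and f :: "nat \<Rightarrow> 'b"
    have "card (f ` {..<n}) \<le> n"
      using card_image_le[of "{..<n}" f] by simp
    then have "\<not> A n \<subseteq> f ` {..<n}"
      using assms[of n] card_mono[of "f ` {..<n}" "A n"] finite_subset[of "A n" "f ` {..<n}"]
      by fastforce
    then show "\<exists>r. r \<in> A n \<and> r \<notin> f ` {..<n}" by blast
  qed
  then obtain h where h: "\<And>n. h n \<in> A n" "\<And>n. h n \<notin> h ` {..<n}" by blast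
  have "h m \<noteq> h n" if "m < n" for m n using h(2)[of n] that by (metis imageI lessThan_iff)
  then have "inj h" by (metis injI linorder_neqE_nat)
  with h(1) show thesis by (rule that[rotated])
qed

section \<open>Superlevel sets and the decreasing rearrangement\<close>

definition superlevel :: "(nat \<Rightarrow> 'a::real_normed_field) \<Rightarrow> real \<Rightarrow> nat set" where
  "superlevel x t = {k. t < norm (x k)}"

definition rearr :: "(nat \<Rightarrow> 'a::real_normed_field) \<Rightarrow> nat \<Rightarrow> real" where
  "rearr x n = (INF J\<in>{J. finite J \<and> card J \<le> n}. SUP k\<in>UNIV - J. norm (x k))"

lemma decreasing_rearrangement_eq: "decreasing_rearrangement x n = of_real (rearr x n)"
  by (simp add: decreasing_rearrangement_def rearr_def)

text \<open>
  Deleting the superlevel set leaves only terms of absolute value at most \<open>t\<close>. Conversely, \<open>n\<close> deletions cannot remove all of \<open>n + 1\<close> chosen terms exceeding \<open>t\<close>, so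
  the suprema stay above the least of these finitely many terms, hence uniformly above \<open>t\<close>.
\<close>
lemma rearr_le_iff:
  fixes x :: "nat \<Rightarrow> 'a::real_normed_field"
  assumes "bounded (range x)"
  shows "rearr x n \<le> t \<longleftrightarrow> finite (superlevel x t) \<and> card (superlevel x t) \<le> n"
proof -
  define s where "s J = (SUP k\<in>UNIV - J. norm (x k))" for J
  define F where "F = {J :: nat set. finite J \<and> card J \<le> n}"
  have r: "rearr x n = (INF J\<in>F. s J)" by (simp add: rearr_def s_def F_def)
  have ne: "F \<noteq> {}" by (auto simp: F_def intro!: exI[of _ "{}"])
  obtain B where B: "\<And>k. norm (x k) \<le> B"
    using assms by (auto simp: bounded_iff)
  have s_ge: "norm (x k) \<le> s J" if "k \<notin> J" for k J
    unfolding s_def using that B by (intro cSUP_upper) (auto intro!: bdd_aboveI)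
  have nonempty: "UNIV - J \<noteq> {}" if "J \<in> F" for J
    using that by (auto simp: F_def Diff_eq_empty_iff) (metis finite_subset infinite_UNIV_nat)
  have "0 \<le> s J" if "J \<in> F" for J
    using nonempty[OF that] s_ge[of _ J] by (meson DiffD2 all_not_in_conv norm_ge_zero order_trans)
  then have bdd: "bdd_below (s ` F)" by (auto intro!: bdd_belowI)
  show ?thesis
  proof
    assume D: "finite (superlevel x t) \<and> card (superlevel x t) \<le> n"
    then have DF: "superlevel x t \<in> F" by (simp add: F_def)
    have "rearr x n \<le> s (superlevel x t)"
      unfolding r by (rule cINF_lower[OF bdd DF])
    also have "\<dots> \<le> t"
      unfolding s_def by (rule cSUP_least[OF nonempty[OF DF]]) (auto simp: superlevel_def)
    finally show "rearr x n \<le> t" .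
  next
    assume le: "rearr x n \<le> t"
    show "finite (superlevel x t) \<and> card (superlevel x t) \<le> n"
    proof (rule ccontr)
      assume neg: "\<not> ?thesis"
      obtain G where G: "finite G" "card G = Suc n" "G \<subseteq> superlevel x t"
      proof (cases "finite (superlevel x t)")
        case True
        then show thesis
          using neg that obtain_subset_with_card_n[of "Suc n" "superlevel x t"]
          by (metis finite_subset not_less_eq_eq)
      next
        case False
        then show thesis
          using that infinite_arbitrarily_large by blast
      qed
      define \<mu> where "\<mu> = Min ((\<lambda>k. norm (x k)) ` G)"
      have "G \<noteq> {}" using G(2) by auto
      then have "t < \<mu>" using G by (auto simp: \<mu>_def superlevel_def)
      moreover have "\<mu> \<le> rearr x n"
        unfolding r
      proof (rule cINF_greatest[OF ne])
        fix J assume "J \<in> F"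
        then have "\<not> G \<subseteq> J" using G(2) card_mono[of J G] by (auto simp: F_def)
        then obtain k where "k \<in> G" "k \<notin> J" by blast
        moreover have "\<mu> \<le> norm (x k)" using G(1) \<open>k \<in> G\<close> by (simp add: \<mu>_def)
        ultimately show "\<mu> \<le> s J" using s_ge[of k J] by linarith
      qed
      ultimately show False using le by linarith
    qed
  qed
qed

lemma rearr_nonneg:
  assumes "bounded (range x)"
  shows "0 \<le> rearr x n"
proof (rule ccontr)
  assume "\<not> ?thesis"
  then have "superlevel x (rearr x n) = UNIV"
    by (auto simp: superlevel_def intro: less_le_trans[OF _ norm_ge_zero])
  then show False using rearr_le_iff[OF assms, of n "rearr x n"] by simp
qed

lemma rearr_permute:
  assumes "bounded (range x)" "bij \<sigma>"
  shows "rearr (\<lambda>n. x (\<sigma> n)) = rearr x"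
proof
  fix n
  have b: "bounded (range (\<lambda>n. x (\<sigma> n)))"
    by (rule bounded_subset[OF assms(1)]) auto
  have "\<sigma> ` superlevel (\<lambda>n. x (\<sigma> n)) t = superlevel x t" for t
    using surj_image_vimage_eq[OF bij_is_surj[OF assms(2)], of "superlevel x t"]
    by (simp add: superlevel_def vimage_def)
  then have "bij_betw \<sigma> (superlevel (\<lambda>n. x (\<sigma> n)) t) (superlevel x t)" for t
    using bij_is_inj[OF assms(2)] by (auto simp: bij_betw_def intro: inj_on_subset)
  then have "rearr (\<lambda>n. x (\<sigma> n)) n \<le> t \<longleftrightarrow> rearr x n \<le> t" for t
    using rearr_le_iff[OF b] rearr_le_iff[OF assms(1)] bij_betw_same_card bij_betw_finite by metis
  then show "rearr (\<lambda>n. x (\<sigma> n)) n = rearr x n"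
    by (meson order_antisym order_refl)
qed

section \<open>Comparing a sequence with its rearrangement\<close>

text \<open>
  More than \<open>n\<close> terms of \<open>|x|\<close> exceed \<open>x\<^sup>*\<^sub>n / q\<close> when \<open>x\<^sup>*\<^sub>n > 0\<close>, so one of them has not been
  taken by the indices before \<open>n\<close>. The factor \<open>q > 1\<close> cannot be omitted: a sequence
  increasing strictly to \<open>1\<close> has the constant rearrangement \<open>1\<close>.
\<close>
lemma rearr_below_sequence:
  assumes "bounded (range x)" "1 < q"
  obtains h where "inj h" "\<And>n. rearr x n \<le> q * norm (x (h n))"
proof -
  define A where "A n = {k. rearr x n \<le> q * norm (x k)}" for n
  have "infinite (A n) \<or> n < card (A n)" for n
  proof (cases "rearr x n = 0")
    case True
    then have "A n = UNIV" using assms(2) by (auto simp: A_def)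
    then show ?thesis by simp
  next
    case False
    then have "\<not> rearr x n \<le> rearr x n / q"
      using rearr_nonneg[OF assms(1), of n] assms(2) by (simp add: field_simps)
    then have "\<not> (finite (superlevel x (rearr x n / q)) \<and> card (superlevel x (rearr x n / q)) \<le> n)"
      using rearr_le_iff[OF assms(1)] by blast
    moreover have "superlevel x (rearr x n / q) \<subseteq> A n"
      using assms(2) by (auto simp: A_def superlevel_def field_simps)
    ultimately show ?thesis
      by (metis card_mono finite_subset not_le_imp_less order_trans)
  qed
  then obtain h where "inj h" "\<And>n. h n \<in> A n" using greedy_injective_choice by blast
  then show thesis using that by (auto simp: A_def)
qed

text \<open>
  The position of \<open>n\<close> when the terms of \<open>|x|\<close> are listed in decreasing order, ties being broken by
  the index. It is meaningful only if finitely many terms are at least as large as \<open>|x\<^sub>n|\<close>.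
\<close>
definition rank :: "(nat \<Rightarrow> 'a::real_normed_field) \<Rightarrow> nat \<Rightarrow> nat" where
  "rank x n = card {k. norm (x n) < norm (x k) \<or> norm (x k) = norm (x n) \<and> k < n}"

lemma inj_on_rank: "inj_on (rank x) {n. finite {k. norm (x n) \<le> norm (x k)}}"
proof -
  let ?R = "\<lambda>n. {k. norm (x n) < norm (x k) \<or> norm (x k) = norm (x n) \<and> k < n}"
  have less: "rank x n < rank x m"
    if fin: "finite {k. norm (x m) \<le> norm (x k)}" and "n \<in> ?R m" for n m
  proof -
    have "finite (?R m)" by (rule finite_subset[OF _ fin]) auto
    moreover have "?R n \<subset> ?R m" using that(2) by auto
    ultimately show ?thesis unfolding rank_def by (rule psubset_card_mono)
  qed
  show ?thesis
  proof (rule inj_onI, rule ccontr)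
    fix m n
    assume *: "m \<in> {n. finite {k. norm (x n) \<le> norm (x k)}}"
      "n \<in> {n. finite {k. norm (x n) \<le> norm (x k)}}" "rank x m = rank x n" "m \<noteq> n"
    then have "n \<in> ?R m \<or> m \<in> ?R n" by auto
    then show False using less[of m n] less[of n m] * by fastforce
  qed
qed

text \<open>
  The index \<open>n\<close> and those listed before it are \<open>rank x n + 1\<close> indices of terms at least as large
  as \<open>|x\<^sub>n|\<close>, one more than the superlevel set at height \<open>rearr x (rank x n)\<close> can contain.
\<close>
lemma norm_le_rearr_rank:
  assumes "bounded (range x)" and fin: "finite {k. norm (x n) \<le> norm (x k)}"
  shows "norm (x n) \<le> rearr x (rank x n)"
proof (rule ccontr)
  assume "\<not> ?thesis"
  then have less: "rearr x (rank x n) < norm (x n)" by simp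
  let ?R = "{k. norm (x n) < norm (x k) \<or> norm (x k) = norm (x n) \<and> k < n}"
  let ?D = "superlevel x (rearr x (rank x n))"
  have D: "finite ?D" "card ?D \<le> rank x n"
    using rearr_le_iff[OF assms(1), of "rank x n" "rearr x (rank x n)"] by auto
  have "finite ?R" by (rule finite_subset[OF _ fin]) auto
  then have "card (insert n ?R) = Suc (rank x n)"
    unfolding rank_def by (subst card_insert_disjoint) auto
  moreover have "insert n ?R \<subseteq> ?D" using less by (auto simp: superlevel_def)
  ultimately show False using D card_mono[of ?D "insert n ?R"] by simp
qed

text \<open>
  For a null sequence the rank does the job with \<open>q = 1\<close>. Otherwise \<open>x\<^sup>*\<close> has a limit \<open>L > 0\<close> and
  ranks may exhaust all indices before the terms \<open>|x\<^sub>n| \<le> L\<close> have been reached. So only the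
  finitely many terms above \<open>q L\<close> are ranked; all others are at most \<open>q x\<^sup>*\<^sub>m\<close> for every \<open>m\<close>
  and can be sent anywhere.
\<close>
lemma sequence_below_rearr:
  fixes x :: "nat \<Rightarrow> 'a::real_normed_field"
  assumes bdd: "bounded (range x)" and q: "1 < q"
  obtains g where "inj_on g {n. x n \<noteq> 0}" "\<And>n. x n \<noteq> 0 \<Longrightarrow> norm (x n) \<le> q * rearr x (g n)"
proof (cases "\<forall>t>0. finite {k. t \<le> norm (x k)}")
  case True
  have "{n. x n \<noteq> 0} \<subseteq> {n. finite {k. norm (x n) \<le> norm (x k)}}" using True by auto
  then have "inj_on (rank x) {n. x n \<noteq> 0}" by (rule inj_on_subset[OF inj_on_rank])
  moreover have "norm (x n) \<le> q * rearr x (rank x n)" if "x n \<noteq> 0" for n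
  proof -
    have "norm (x n) \<le> 1 * rearr x (rank x n)"
      using norm_le_rearr_rank[OF bdd] True that by simp
    also have "\<dots> \<le> q * rearr x (rank x n)"
      using q rearr_nonneg[OF bdd] by (intro mult_right_mono) auto
    finally show ?thesis .
  qed
  ultimately show thesis by (rule that)
next
  case False
  then obtain t where t: "0 < t" "infinite {k. t \<le> norm (x k)}" by blast
  have t_le: "t \<le> rearr x n" for n
  proof (rule ccontr)
    assume "\<not> ?thesis"
    then have "{k. t \<le> norm (x k)} \<subseteq> superlevel x (rearr x n)" by (auto simp: superlevel_def)
    then show False using t(2) rearr_le_iff[OF bdd, of n "rearr x n"] finite_subset by auto
  qed
  define L where "L = (INF n. rearr x n)"
  have L_le: "L \<le> rearr x n" for n
    unfolding L_def by (rule cINF_lower) (auto intro!: bdd_belowI t_le)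
  have "t \<le> L" unfolding L_def by (rule cINF_greatest) (auto intro: t_le)
  then have "L < q * L" using t(1) q by simp
  then obtain m where "rearr x m < q * L"
    unfolding L_def using cInf_lessD[of "range (rearr x)"] by auto
  then have fin: "finite (superlevel x (q * L))"
    using rearr_le_iff[OF bdd, of m "q * L"] by simp
  have sub: "finite {k. norm (x n) \<le> norm (x k)}" if "n \<in> superlevel x (q * L)" for n
    by (rule finite_subset[OF _ fin]) (use that in \<open>auto simp: superlevel_def\<close>)
  define D where "D = superlevel x (q * L)"
  obtain M where M: "\<And>n. n \<in> D \<Longrightarrow> rank x n < M"
    using fin finite_nat_set_iff_bounded[of "rank x ` D"] by (auto simp: D_def)
  define g where "g n = (if n \<in> D then rank x n else M + n)" for n
  have inj: "inj_on (rank x) D"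
    by (rule inj_on_subset[OF inj_on_rank]) (use sub in \<open>auto simp: D_def\<close>)
  have "inj g"
  proof (rule injI)
    fix a b assume "g a = g b"
    then show "a = b"
      using inj M[of a] M[of b] by (auto simp: g_def inj_on_def split: if_splits)
  qed
  moreover have "norm (x n) \<le> q * rearr x (g n)" for n
  proof (cases "n \<in> D")
    case True
    then have "norm (x n) \<le> 1 * rearr x (g n)"
      using norm_le_rearr_rank[OF bdd] sub by (simp add: g_def D_def)
    also have "\<dots> \<le> q * rearr x (g n)"
      using q rearr_nonneg[OF bdd] by (intro mult_right_mono) auto
    finally show ?thesis .
  next
    case False
    then have "norm (x n) \<le> q * L" by (simp add: D_def superlevel_def)
    also have "\<dots> \<le> q * rearr x (g n)" using L_le q by simp
    finally show ?thesis .
  qed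
  ultimately show thesis by (intro that[of g]) (auto intro: inj_on_subset)
qed

section \<open>Domination in symmetric sequence spaces\<close>

context banach_sequence_space
begin

lemma bounded_of_mem:
  assumes "x \<in> X"
  shows "bounded (range x)"
proof -
  have "norm (x k) \<le> N x" for k
  proof -
    have "norm (x k) = N (\<lambda>n. x k * unit_seq k n)"
      using norm_scale[OF unit_mem] norm_unit by simp
    also have "\<dots> \<le> N x" by (rule solid_norm[OF assms]) (simp add: unit_seq_def)
    finally show ?thesis .
  qed
  then show ?thesis by (auto simp: bounded_iff)
qed

lemma sum_mem_and_norm_sum:
  assumes "finite I" "\<And>i. i \<in> I \<Longrightarrow> w i \<in> X"
  shows "(\<lambda>n. \<Sum>i\<in>I. w i n) \<in> X \<and> N (\<lambda>n. \<Sum>i\<in>I. w i n) \<le> (\<Sum>i\<in>I. N (w i))"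
  using assms
proof (induction I rule: finite_induct)
  case empty
  then show ?case using zero_mem norm_eq_zero[OF zero_mem] by simp
next
  case (insert i I)
  then have IH: "(\<lambda>n. \<Sum>i\<in>I. w i n) \<in> X" "N (\<lambda>n. \<Sum>i\<in>I. w i n) \<le> (\<Sum>i\<in>I. N (w i))"
    and wi: "w i \<in> X" by auto
  show ?case
    using insert(1,2) add_mem[OF wi IH(1)] norm_triangle[OF wi IH(1)] IH(2) by simp
qed

lemma domination_with_room:
  assumes sym: "symmetric_space X N" and u: "u \<in> X"
    and "inj_on g {n. v n \<noteq> 0}" "infinite (- {n. v n \<noteq> 0})" "infinite (- g ` {n. v n \<noteq> 0})"
    and le: "\<And>n. v n \<noteq> 0 \<Longrightarrow> norm (v n) \<le> norm (u (g n))"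
  shows "v \<in> X \<and> N v \<le> N u"
proof -
  obtain \<sigma> where \<sigma>: "bij \<sigma>" "\<And>n. n \<in> {n. v n \<noteq> 0} \<Longrightarrow> \<sigma> n = g n"
    by (rule injection_extends_to_bijection[OF assms(3-5)], rule that, assumption) simp
  have u\<sigma>: "(\<lambda>n. u (\<sigma> n)) \<in> X" "N (\<lambda>n. u (\<sigma> n)) = N u"
    using sym u \<sigma>(1) by (auto simp: symmetric_space_def)
  have "norm (v n) \<le> norm (u (\<sigma> n))" for n
    using le[of n] \<sigma>(2)[of n] by (cases "v n = 0") auto
  then show ?thesis using solid_mem[OF u\<sigma>(1), of v] solid_norm[OF u\<sigma>(1), of v] u\<sigma>(2) by simp
qed

text \<open>
  The heart of the matter: averaging over truncations of \<open>v\<close> makes room for extending \<open>g\<close>, at the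
  price of a factor that can be taken arbitrarily close to \<open>1\<close>.
\<close>
lemma injective_domination:
  fixes u v :: "nat \<Rightarrow> 'a"
  assumes sym: "symmetric_space X N" and u: "u \<in> X"
    and inj: "inj_on g {n. v n \<noteq> 0}"
    and le: "\<And>n. v n \<noteq> 0 \<Longrightarrow> norm (v n) \<le> norm (u (g n))"
  shows "v \<in> X \<and> N v \<le> N u"
proof (cases "finite {n. v n \<noteq> 0}")
  case True
  then show ?thesis
    by (intro domination_with_room[OF sym u inj _ _ le] finite_imageI) simp_all
next
  case False
  have average: "v \<in> X \<and> real m * N v \<le> real (Suc m) * N u" if m: "0 < m" for m
  proof -
    obtain c where c: "\<And>n. c n < Suc m" "\<And>i. i < Suc m \<Longrightarrow> infinite {n \<in> {n. v n \<noteq> 0}. c n = i}"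
      using infinite_set_colouring[OF False, of "Suc m"] by blast
    define w where "w i n = (if c n = i then 0 else v n)" for i n
    have w: "w i \<in> X \<and> N (w i) \<le> N u" if i: "i < Suc m" for i
    proof (rule domination_with_room[OF sym u])
      let ?P = "{n \<in> {n. v n \<noteq> 0}. c n = i}"
      show "inj_on g {n. w i n \<noteq> 0}"
        by (rule inj_on_subset[OF inj]) (auto simp: w_def)
      have "?P \<subseteq> - {n. w i n \<noteq> 0}" by (auto simp: w_def)
      then show "infinite (- {n. w i n \<noteq> 0})" using c(2)[OF i] finite_subset by blast
      have "g ` ?P \<subseteq> - g ` {n. w i n \<noteq> 0}"
        using inj by (auto simp: w_def inj_on_def)
      moreover have "infinite (g ` ?P)"
        using c(2)[OF i] inj_on_subset[OF inj, of ?P] by (auto dest: finite_imageD)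
      ultimately show "infinite (- g ` {n. w i n \<noteq> 0})" using finite_subset by blast
      show "norm (w i n) \<le> norm (u (g n))" if "w i n \<noteq> 0" for n
        using that le[of n] by (auto simp: w_def split: if_splits)
    qed
    \<comment> \<open>Each index belongs to exactly one piece, so exactly one of the \<open>m + 1\<close> truncations
        vanishes there.\<close>
    have sum: "(\<Sum>i<Suc m. w i n) = of_nat m * v n" for n
    proof -
      have "(\<Sum>i<Suc m. w i n) = (\<Sum>i\<in>{..<Suc m} - {c n}. v n)"
        by (rule sum.mono_neutral_cong_right) (auto simp: w_def)
      then show ?thesis using c(1)[of n] by simp
    qed
    have mv: "(\<lambda>n. of_nat m * v n) \<in> X" "N (\<lambda>n. of_nat m * v n) \<le> (\<Sum>i<Suc m. N (w i))"
      using sum_mem_and_norm_sum[of "{..<Suc m}" w] w unfolding sum by auto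
    have "(\<lambda>n. inverse (of_nat m) * (of_nat m * v n)) \<in> X" by (rule scale_mem[OF mv(1)])
    then have v: "v \<in> X" using m by (simp add: mult.assoc[symmetric])
    have "real m * N v = N (\<lambda>n. of_nat m * v n)" using norm_scale[OF v, of "of_nat m"] by simp
    also have "\<dots> \<le> (\<Sum>i<Suc m. N u)"
      by (rule order_trans[OF mv(2)], rule sum_mono) (use w in auto)
    finally show ?thesis using v by simp
  qed
  have "N v \<le> N u"
  proof (rule ccontr)
    assume "\<not> ?thesis"
    then obtain m where m: "N u < real m * (N v - N u)"
      using ex_less_of_nat_mult[of "N v - N u" "N u"] by auto
    then have "0 < m" using norm_nonneg[OF u] by (cases m) auto
    then show False using average[of m] m by (simp add: algebra_simps)
  qed
  then show ?thesis using average[of 1] by simp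
qed

lemma approximate_injective_domination:
  fixes u v :: "nat \<Rightarrow> 'a"
  assumes sym: "symmetric_space X N" and u: "u \<in> X"
    and ex: "\<And>q. 1 < q \<Longrightarrow> \<exists>g. inj_on g {n. v n \<noteq> 0} \<and>
               (\<forall>n. v n \<noteq> 0 \<longrightarrow> norm (v n) \<le> q * norm (u (g n)))"
  shows "v \<in> X \<and> N v \<le> N u"
proof -
  have scaled: "v \<in> X \<and> N v \<le> q * N u" if q: "1 < q" for q
  proof -
    obtain g where g: "inj_on g {n. v n \<noteq> 0}"
      "\<forall>n. v n \<noteq> 0 \<longrightarrow> norm (v n) \<le> q * norm (u (g n))"
      using ex[OF q] by (elim exE conjE)
    have "v \<in> X \<and> N v \<le> N (\<lambda>n. of_real q * u n)"
      by (rule injective_domination[OF sym scale_mem[OF u] g(1)])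
        (use g(2) q in \<open>auto simp: norm_mult\<close>)
    then show ?thesis using norm_scale[OF u, of "of_real q"] q by simp
  qed
  have "N v \<le> N u + e" if "0 < e" for e
  proof -
    \<comment> \<open>The summand \<open>1\<close> in the denominator allows for \<open>N u = 0\<close>.\<close>
    define q where "q = 1 + e / (N u + 1)"
    have pos: "0 < N u + 1" using norm_nonneg[OF u] by simp
    then have "1 < q" using that by (simp add: q_def)
    then have "N v \<le> q * N u" using scaled by blast
    also have "\<dots> = N u + e * (N u / (N u + 1))" by (simp add: q_def algebra_simps)
    also have "\<dots> \<le> N u + e * 1"
      using pos that by (intro add_left_mono mult_left_mono) auto
    finally show ?thesis by simp
  qed
  then have "N v \<le> N u" by (rule field_le_epsilon)
  then show ?thesis using scaled[of 2] by simp
qed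

section \<open>Symmetry and rearrangement invariance\<close>

theorem symmetric_iff_rearrangement_invariant:
  "symmetric_space X N \<longleftrightarrow>
    (\<forall>x. bounded (range x) \<longrightarrow>
      (x \<in> X \<longleftrightarrow> decreasing_rearrangement x \<in> X) \<and>
      (x \<in> X \<longrightarrow> N x = N (decreasing_rearrangement x)))"
  (is "_ \<longleftrightarrow> (\<forall>x. bounded (range x) \<longrightarrow> ?P x)")
proof
  assume sym: "symmetric_space X N"
  show "\<forall>x. bounded (range x) \<longrightarrow> ?P x"
  proof (intro allI impI)
    fix x :: "nat \<Rightarrow> 'a" assume bdd: "bounded (range x)"
    let ?y = "decreasing_rearrangement x :: nat \<Rightarrow> 'a"
    have norm_y: "norm (?y n) = rearr x n" for n
      using rearr_nonneg[OF bdd, of n] by (simp add: decreasing_rearrangement_eq)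
    have down: "?y \<in> X \<and> N ?y \<le> N x" if "x \<in> X"
    proof (rule approximate_injective_domination[OF sym that])
      fix q :: real assume q: "1 < q"
      obtain h where h: "inj h" "\<And>n. rearr x n \<le> q * norm (x (h n))"
        by (rule rearr_below_sequence[OF bdd q], rule that) simp_all
      show "\<exists>g. inj_on g {n. ?y n \<noteq> 0} \<and>
          (\<forall>n. ?y n \<noteq> 0 \<longrightarrow> norm (?y n) \<le> q * norm (x (g n)))"
        unfolding norm_y using h by (intro exI[of _ h]) (auto intro: inj_on_subset)
    qed
    have up: "x \<in> X \<and> N x \<le> N ?y" if "?y \<in> X"
    proof (rule approximate_injective_domination[OF sym that])
      fix q :: real assume q: "1 < q"
      obtain g where g: "inj_on g {n. x n \<noteq> 0}"
          "\<And>n. x n \<noteq> 0 \<Longrightarrow> norm (x n) \<le> q * rearr x (g n)"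
        by (rule sequence_below_rearr[OF bdd q], rule that) simp_all
      show "\<exists>g. inj_on g {n. x n \<noteq> 0} \<and>
          (\<forall>n. x n \<noteq> 0 \<longrightarrow> norm (x n) \<le> q * norm (?y (g n)))"
        unfolding norm_y using g by (intro exI[of _ g]) auto
    qed
    show "?P x" using down up by (auto intro: order_antisym)
  qed
next
  assume inv: "\<forall>x. bounded (range x) \<longrightarrow> ?P x"
  show "symmetric_space X N"
    unfolding symmetric_space_def
  proof (intro ballI allI impI)
    fix x :: "nat \<Rightarrow> 'a" and \<sigma> :: "nat \<Rightarrow> nat"
    assume x: "x \<in> X" and \<sigma>: "bij \<sigma>"
    have bdd: "bounded (range x)" by (rule bounded_of_mem[OF x])
    have "bounded (range (\<lambda>n. x (\<sigma> n)))" by (rule bounded_subset[OF bdd]) auto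
    moreover have "(decreasing_rearrangement (\<lambda>n. x (\<sigma> n)) :: nat \<Rightarrow> 'a)
        = decreasing_rearrangement x"
      by (rule ext) (simp add: decreasing_rearrangement_eq rearr_permute[OF bdd \<sigma>])
    ultimately show "(\<lambda>n. x (\<sigma> n)) \<in> X \<and> N (\<lambda>n. x (\<sigma> n)) = N x"
      using inv[rule_format, of "\<lambda>n. x (\<sigma> n)"] inv[rule_format, OF bdd] x by simp
  qed
qed

end

theorem theorem1p1:
  shows "(\<forall>(X :: (nat \<Rightarrow> real) set) N. banach_sequence_space X N \<longrightarrow>
           (symmetric_space X N \<longleftrightarrow>
             (\<forall>x. bounded (range x) \<longrightarrow>
               (x \<in> X \<longleftrightarrow> decreasing_rearrangement x \<in> X) \<and>
               (x \<in> X \<longrightarrow> N x = N (decreasing_rearrangement x)))))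
       \<and> (\<forall>(X :: (nat \<Rightarrow> complex) set) N. banach_sequence_space X N \<longrightarrow>
           (symmetric_space X N \<longleftrightarrow>
             (\<forall>x. bounded (range x) \<longrightarrow>
               (x \<in> X \<longleftrightarrow> decreasing_rearrangement x \<in> X) \<and>
               (x \<in> X \<longrightarrow> N x = N (decreasing_rearrangement x)))))"
  by (rule conjI; rule allI; rule allI; rule impI;
      erule banach_sequence_space.symmetric_iff_rearrangement_invariant)

end
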